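(* Let $R$ be a commutative ring, let $\mathscr{F}$ be an idempotent topologizing system on $R$, and let $\phi:M\rightarrow N$ be an $R$-linear map of $R$-modules such that $\operatorname{Ker}\phi$ and $\operatorname{Coker}\phi$ are $\mathscr{F}$-negligible. Then $\phi_{\mathscr{F}}:M_{\mathscr{F}}\rightarrow N_{\mathscr{F}}$ is bijective.
   Context: All rings are commutative. A topologizing system on a ring $R$ is a non-empty family $\mathscr{F}$ of ideals of $R$ such that every ideal containing a member of $\mathscr{F}$ belongs to $\mathscr{F}$, and $\mathscr{F}$ is stable under finite intersections. An $R$-module $M$ is $\mathscr{F}$-negligible if $\operatorname{Ann}_R(m)\in\mathscr{F}$ for every $m\in M$. For topologizing systems $\mathscr{F},\mathscr{G}$ on $R$, $\mathscr{F}.\mathscr{G}$ is the set of ideals $I$ of $R$ for which there is $J\in\mathscr{G}$ with $I\subseteq J$ and $J/I$ $\mathscr{F}$-negligible; $\mathscr{F}$ is idempotent if $\mathscr{F}.\mathscr{F}=\mathscr{F}$. For an $R$-module $M$, $\mathscr{F}(M)=\{m\in M:\operatorname{Ann}_R(m)\in\mathscr{F}\}$ (a submodule), and the Gabriel localization is $M_{\mathscr{F}}=\operatorname{colim}_{I\in\mathscr{F}}\operatorname{Hom}_R(I,M/\mathscr{F}(M))$, where $\mathscr{F}$ is directed by reverse inclusion and the transition maps are restrictions; $[f]$ denotes the class of $f:I\to M/\mathscr{F}(M)$. For an $R$-linear map $u:M\to N$, the map $u_{\mathscr{F}}:M_{\mathscr{F}}\to N_{\mathscr{F}}$ is $[f]\mapsto[\overline{u}\circ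 f]$, where $\overline{u}:M/\mathscr{F}(M)\to N/\mathscr{F}(N)$ is induced by $u$. *)

theory Defs
  imports "HOL-Algebra.Module" "HOL-Algebra.Ideal"
begin

section \<open>Modules\<close>

definition mod_hom ::
    "('a, 'r) ring_scheme \<Rightarrow> ('a, 'b, 'm) module_scheme \<Rightarrow> ('a, 'c, 'n) module_scheme \<Rightarrow> ('b \<Rightarrow> 'c) set"
  where "mod_hom R M N = {u \<in> hom (add_monoid M) (add_monoid N).
    \<forall>a \<in> carrier R. \<forall>x \<in> carrier M. u (a \<odot>\<^bsub>M\<^esub> x) = a \<odot>\<^bsub>N\<^esub> u x}"

text \<open>The fields \<^const>\<open>mult\<close> and \<^const>\<open>one\<close> of a \<^typ>\<open>('a, 'b) module\<close> play no role in
  the locale \<^locale>\<open>module\<close>; they are left \<^const>\<open>undefined\<close> in the constructions below.\<close>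

definition ideal_mod :: "('a, 'r) ring_scheme \<Rightarrow> 'a set \<Rightarrow> ('a, 'a) module"
  where "ideal_mod R I =
    \<lparr>carrier = I, mult = undefined, one = undefined, zero = \<zero>\<^bsub>R\<^esub>, add = add R, smult = mult R\<rparr>"

text \<open>As for \<^const>\<open>set_add\<close>, operations on classes are defined as unions over all
  representatives. Each such union is a single class, see the lemmas below.\<close>

definition quot_mod :: "('a, 'b, 'm) module_scheme \<Rightarrow> 'b set \<Rightarrow> ('a, 'b set) module"
  where "quot_mod M H =
    \<lparr>carrier = a_rcosets\<^bsub>M\<^esub> H, mult = undefined, one = undefined, zero = H, add = set_add M,
     smult = (\<lambda>a X. \<Union>x\<in>X. H +>\<^bsub>M\<^esub> (a \<odot>\<^bsub>M\<^esub> x))\<rparr>"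

definition quot_map :: "('a, 'c, 'n) module_scheme \<Rightarrow> 'c set \<Rightarrow> ('b \<Rightarrow> 'c) \<Rightarrow> 'b set \<Rightarrow> 'c set"
  where "quot_map N K u X = (\<Union>x\<in>X. K +>\<^bsub>N\<^esub> u x)"

definition ker_mod ::
    "('a, 'b, 'm) module_scheme \<Rightarrow> ('a, 'c, 'n) module_scheme \<Rightarrow> ('b \<Rightarrow> 'c) \<Rightarrow> ('a, 'b, 'm) module_scheme"
  where "ker_mod M N u = M\<lparr>carrier := a_kernel M N u\<rparr>"

definition coker_mod ::
    "('a, 'b, 'm) module_scheme \<Rightarrow> ('a, 'c, 'n) module_scheme \<Rightarrow> ('b \<Rightarrow> 'c) \<Rightarrow> ('a, 'c set) module"
  where "coker_mod M N u = quot_mod N (u ` carrier M)"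

definition annihilator :: "('a, 'r) ring_scheme \<Rightarrow> ('a, 'b, 'm) module_scheme \<Rightarrow> 'b \<Rightarrow> 'a set"
  where "annihilator R M m = {a \<in> carrier R. a \<odot>\<^bsub>M\<^esub> m = \<zero>\<^bsub>M\<^esub>}"


section \<open>Topologizing systems\<close>

text \<open>The empty intersection \<^term>\<open>carrier R\<close> belongs to every topologizing system by the
  first three conditions.\<close>

locale topologizing_system = cring R for R (structure) +
  fixes \<F> :: "'a set set"
  assumes nonempty: "\<F> \<noteq> {}"
    and ideals: "I \<in> \<F> \<Longrightarrow> ideal I R"
    and upward: "\<lbrakk>I \<in> \<F>; ideal J R; I \<subseteq> J\<rbrakk> \<Longrightarrow> J \<in> \<F>"
    and inter: "\<lbrakk>I \<in> \<F>; J \<in> \<F>\<rbrakk> \<Longrightarrow> I \<inter> J \<in> \<F>"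

definition negligible :: "('a, 'r) ring_scheme \<Rightarrow> 'a set set \<Rightarrow> ('a, 'b, 'm) module_scheme \<Rightarrow> bool"
  where "negligible R \<F> M \<longleftrightarrow> (\<forall>m \<in> carrier M. annihilator R M m \<in> \<F>)"

definition ts_prod :: "('a, 'r) ring_scheme \<Rightarrow> 'a set set \<Rightarrow> 'a set set \<Rightarrow> 'a set set"
  where "ts_prod R \<F> \<G> =
    {I. ideal I R \<and> (\<exists>J \<in> \<G>. I \<subseteq> J \<and> negligible R \<F> (quot_mod (ideal_mod R J) I))}"

definition ts_idempotent :: "('a, 'r) ring_scheme \<Rightarrow> 'a set set \<Rightarrow> bool"
  where "ts_idempotent R \<F> \<longleftrightarrow> ts_prod R \<F> \<F> = \<F>"


section \<open>Gabriel localization\<close>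

definition torsion :: "('a, 'r) ring_scheme \<Rightarrow> 'a set set \<Rightarrow> ('a, 'b, 'm) module_scheme \<Rightarrow> 'b set"
  where "torsion R \<F> M = {m \<in> carrier M. annihilator R M m \<in> \<F>}"

text \<open>The disjoint union of the sets Hom(\<open>I\<close>, \<open>M / torsion R \<F> M\<close>) over all members \<open>I\<close> of the system.
  Extensionality makes a homomorphism on \<open>I\<close> determined by its values on \<open>I\<close>.\<close>

definition loc_pre ::
    "('a, 'r) ring_scheme \<Rightarrow> 'a set set \<Rightarrow> ('a, 'b, 'm) module_scheme \<Rightarrow> ('a set \<times> ('a \<Rightarrow> 'b set)) set"
  where "loc_pre R \<F> M = (SIGMA I:\<F>.
    mod_hom R (ideal_mod R I) (quot_mod M (torsion R \<F> M)) \<inter> extensional I)"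

text \<open>The colimit is directed: two homomorphisms have the same class iff their restrictions to
  some common smaller member of the system agree.\<close>

definition loc_rel ::
    "('a, 'r) ring_scheme \<Rightarrow> 'a set set \<Rightarrow> ('a, 'b, 'm) module_scheme \<Rightarrow>
      ((_ \<times> ('a \<Rightarrow> 'b set)) \<times> (_ \<times> ('a \<Rightarrow> 'b set))) set"
  where "loc_rel R \<F> M = {((I, f), (J, g)). (I, f) \<in> loc_pre R \<F> M \<and> (J, g) \<in> loc_pre R \<F> M \<and>
    (\<exists>K \<in> \<F>. K \<subseteq> I \<inter> J \<and> restrict f K = restrict g K)}"

definition loc_class ::
    "('a, 'r) ring_scheme \<Rightarrow> 'a set set \<Rightarrow> ('a, 'b, 'm) module_scheme \<Rightarrow>
      'a set \<Rightarrow> ('a \<Rightarrow> 'b set) \<Rightarrow> ('a set \<times> ('a \<Rightarrow> 'b set)) set"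
  where "loc_class R \<F> M I f = loc_rel R \<F> M `` {(I, f)}"

definition localization ::
    "('a, 'r) ring_scheme \<Rightarrow> 'a set set \<Rightarrow> ('a, 'b, 'm) module_scheme \<Rightarrow>
      ('a, ('a set \<times> ('a \<Rightarrow> 'b set)) set) module"
  where "localization R \<F> M = (let Q = quot_mod M (torsion R \<F> M) in
    \<lparr>carrier = loc_pre R \<F> M // loc_rel R \<F> M,
     mult = undefined, one = undefined,
     zero = loc_class R \<F> M (carrier R) (\<lambda>x \<in> carrier R. \<zero>\<^bsub>Q\<^esub>),
     add = (\<lambda>X Y. \<Union>(I, f) \<in> X. \<Union>(J, g) \<in> Y.
       loc_class R \<F> M (I \<inter> J) (\<lambda>x \<in> I \<inter> J. f x \<oplus>\<^bsub>Q\<^esub> g x)),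
     smult = (\<lambda>a X. \<Union>(I, f) \<in> X. loc_class R \<F> M I (\<lambda>x \<in> I. a \<odot>\<^bsub>Q\<^esub> f x))\<rparr>)"

definition localization_map ::
    "('a, 'r) ring_scheme \<Rightarrow> 'a set set \<Rightarrow> ('a, 'b, 'm) module_scheme \<Rightarrow> ('a, 'c, 'n) module_scheme \<Rightarrow>
      ('b \<Rightarrow> 'c) \<Rightarrow> ('a set \<times> ('a \<Rightarrow> 'b set)) set \<Rightarrow> ('a set \<times> ('a \<Rightarrow> 'c set)) set"
  where "localization_map R \<F> M N u X = (\<Union>(I, f) \<in> X.
    loc_class R \<F> N I (\<lambda>x \<in> I. quot_map N (torsion R \<F> N) u (f x)))"


section \<open>Well-definedness of the constructions\<close>

lemma mod_homI:
  assumes "\<And>x. x \<in> carrier M \<Longrightarrow> u x \<in> carrier N"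
    and "\<And>x y. \<lbrakk>x \<in> carrier M; y \<in> carrier M\<rbrakk> \<Longrightarrow> u (x \<oplus>\<^bsub>M\<^esub> y) = u x \<oplus>\<^bsub>N\<^esub> u y"
    and "\<And>a x. \<lbrakk>a \<in> carrier R; x \<in> carrier M\<rbrakk> \<Longrightarrow> u (a \<odot>\<^bsub>M\<^esub> x) = a \<odot>\<^bsub>N\<^esub> u x"
  shows "u \<in> mod_hom R M N"
  using assms by (auto simp: mod_hom_def hom_def)

lemma mod_homD:
  assumes "u \<in> mod_hom R M N"
  shows "x \<in> carrier M \<Longrightarrow> u x \<in> carrier N"
    and "\<lbrakk>x \<in> carrier M; y \<in> carrier M\<rbrakk> \<Longrightarrow> u (x \<oplus>\<^bsub>M\<^esub> y) = u x \<oplus>\<^bsub>N\<^esub> u y"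
    and "\<lbrakk>a \<in> carrier R; x \<in> carrier M\<rbrakk> \<Longrightarrow> u (a \<odot>\<^bsub>M\<^esub> x) = a \<odot>\<^bsub>N\<^esub> u x"
  using assms by (auto simp: mod_hom_def hom_def)

lemma ideal_mod_simps [simp]:
  "carrier (ideal_mod R I) = I" "\<zero>\<^bsub>ideal_mod R I\<^esub> = \<zero>\<^bsub>R\<^esub>"
  "x \<oplus>\<^bsub>ideal_mod R I\<^esub> y = x \<oplus>\<^bsub>R\<^esub> y" "a \<odot>\<^bsub>ideal_mod R I\<^esub> x = a \<otimes>\<^bsub>R\<^esub> x"
  by (simp_all add: ideal_mod_def)

lemma quot_mod_simps [simp]:
  "carrier (quot_mod M H) = a_rcosets\<^bsub>M\<^esub> H" "\<zero>\<^bsub>quot_mod M H\<^esub> = H"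
  "X \<oplus>\<^bsub>quot_mod M H\<^esub> Y = X <+>\<^bsub>M\<^esub> Y"
  by (simp_all add: quot_mod_def)

lemma ideal_mod_module:
  assumes "cring R" "ideal I R"
  shows "module R (ideal_mod R I)"
proof -
  interpret R: cring R by fact
  interpret I: ideal I R by fact
  show ?thesis
  proof (rule moduleI)
    show "abelian_group (ideal_mod R I)"
    proof (rule abelian_groupI, simp_all)
      fix x assume x: "x \<in> I"
      then have "\<ominus>\<^bsub>R\<^esub> x \<in> I" "\<ominus>\<^bsub>R\<^esub> x \<oplus>\<^bsub>R\<^esub> x = \<zero>\<^bsub>R\<^esub>"
        using I.a_Hcarr R.l_neg by auto
      then show "\<exists>y\<in>I. y \<oplus>\<^bsub>R\<^esub> x = \<zero>\<^bsub>R\<^esub>" by blast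
    qed (auto simp: I.a_Hcarr R.a_assoc intro: R.a_comm)
  qed (use assms in \<open>auto simp: I.a_Hcarr I.I_l_closed R.l_distr R.r_distr R.m_assoc\<close>)
qed

lemma submodule_abelian_subgroup:
  assumes "module R M" "submodule H R M"
  shows "abelian_subgroup H M"
proof -
  interpret M: module R M by fact
  show ?thesis
    by (rule abelian_subgroupI3[OF additive_subgroupI[OF submodule.axioms(1)[OF assms(2)]]
          M.abelian_group_axioms])
qed

lemma quot_mod_smult:
  assumes "module R M" "submodule H R M" "a \<in> carrier R" "x \<in> carrier M"
  shows "a \<odot>\<^bsub>quot_mod M H\<^esub> (H +>\<^bsub>M\<^esub> x) = H +>\<^bsub>M\<^esub> (a \<odot>\<^bsub>M\<^esub> x)"
proof -
  interpret M: module R M by fact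
  interpret H: abelian_subgroup H M using submodule_abelian_subgroup assms by blast
  have "H +>\<^bsub>M\<^esub> (a \<odot>\<^bsub>M\<^esub> y) = H +>\<^bsub>M\<^esub> (a \<odot>\<^bsub>M\<^esub> x)" if y: "y \<in> H +>\<^bsub>M\<^esub> x" for y
  proof -
    obtain h where h: "h \<in> H" "y = h \<oplus>\<^bsub>M\<^esub> x" using y by (auto simp: a_r_coset_def')
    have "a \<odot>\<^bsub>M\<^esub> y = a \<odot>\<^bsub>M\<^esub> h \<oplus>\<^bsub>M\<^esub> a \<odot>\<^bsub>M\<^esub> x" using h assms H.a_Hcarr by (simp add: M.smult_r_distr)
    moreover have "a \<odot>\<^bsub>M\<^esub> h \<in> H" using h assms submodule.smult_closed by metis
    ultimately have "a \<odot>\<^bsub>M\<^esub> y \<in> H +>\<^bsub>M\<^esub> (a \<odot>\<^bsub>M\<^esub> x)" by (auto simp: a_r_coset_def')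
    then show ?thesis using assms by (intro H.a_repr_independence'[symmetric]) auto
  qed
  moreover have "x \<in> H +>\<^bsub>M\<^esub> x" using assms H.a_rcos_self by blast
  ultimately have "(\<Union>y\<in>H +>\<^bsub>M\<^esub> x. H +>\<^bsub>M\<^esub> (a \<odot>\<^bsub>M\<^esub> y)) = H +>\<^bsub>M\<^esub> (a \<odot>\<^bsub>M\<^esub> x)"
    by (intro SUP_eq_const) blast+
  then show ?thesis by (simp add: quot_mod_def)
qed

lemma quot_mod_add:
  assumes "module R M" "submodule H R M" "x \<in> carrier M" "y \<in> carrier M"
  shows "(H +>\<^bsub>M\<^esub> x) \<oplus>\<^bsub>quot_mod M H\<^esub> (H +>\<^bsub>M\<^esub> y) = H +>\<^bsub>M\<^esub> (x \<oplus>\<^bsub>M\<^esub> y)"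
proof -
  interpret H: abelian_subgroup H M using submodule_abelian_subgroup assms by blast
  show ?thesis using assms by (simp add: H.a_rcos_sum)
qed

lemma quot_mod_cases:
  assumes "X \<in> carrier (quot_mod M H)"
  obtains x where "x \<in> carrier M" "X = H +>\<^bsub>M\<^esub> x"
  using assms by (auto simp: A_RCOSETS_def')

lemma quot_mod_closed: "x \<in> carrier M \<Longrightarrow> H +>\<^bsub>M\<^esub> x \<in> carrier (quot_mod M H)"
  by (auto simp: A_RCOSETS_def')

lemma quot_mod_module:
  assumes "module R M" "submodule H R M"
  shows "module R (quot_mod M H)"
proof -
  interpret M: module R M by fact
  interpret H: abelian_subgroup H M using submodule_abelian_subgroup assms by blast
  let ?Q = "quot_mod M H"
  note add = quot_mod_add[OF assms] and smult = quot_mod_smult[OF assms]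
  have zero: "\<zero>\<^bsub>?Q\<^esub> = H +>\<^bsub>M\<^esub> \<zero>\<^bsub>M\<^esub>" by (simp add: M.M.a_coset_add_zero H.a_subset)
  show ?thesis
  proof (rule moduleI)
    show "abelian_group ?Q"
    proof (rule abelian_groupI)
      show "\<zero>\<^bsub>?Q\<^esub> \<in> carrier ?Q" unfolding zero by (rule quot_mod_closed) simp
      fix X assume "X \<in> carrier ?Q"
      then obtain x where x: "x \<in> carrier M" "X = H +>\<^bsub>M\<^esub> x" by (rule quot_mod_cases)
      show "\<zero>\<^bsub>?Q\<^esub> \<oplus>\<^bsub>?Q\<^esub> X = X" using x by (simp add: zero add del: quot_mod_simps)
      have "(H +>\<^bsub>M\<^esub> (\<ominus>\<^bsub>M\<^esub> x)) \<oplus>\<^bsub>?Q\<^esub> X = \<zero>\<^bsub>?Q\<^esub>"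
        using x by (simp add: zero add M.M.l_neg del: quot_mod_simps)
      then show "\<exists>Y\<in>carrier ?Q. Y \<oplus>\<^bsub>?Q\<^esub> X = \<zero>\<^bsub>?Q\<^esub>"
        using quot_mod_closed[of "\<ominus>\<^bsub>M\<^esub> x" M H] x by blast
      fix Y assume "Y \<in> carrier ?Q"
      then obtain y where y: "y \<in> carrier M" "Y = H +>\<^bsub>M\<^esub> y" by (rule quot_mod_cases)
      show "X \<oplus>\<^bsub>?Q\<^esub> Y \<in> carrier ?Q"
        using x y by (simp add: add quot_mod_closed del: quot_mod_simps)
      show "X \<oplus>\<^bsub>?Q\<^esub> Y = Y \<oplus>\<^bsub>?Q\<^esub> X"
        using x y by (simp add: add M.M.a_comm del: quot_mod_simps)
      fix Z assume "Z \<in> carrier ?Q"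
      then obtain z where z: "z \<in> carrier M" "Z = H +>\<^bsub>M\<^esub> z" by (rule quot_mod_cases)
      show "X \<oplus>\<^bsub>?Q\<^esub> Y \<oplus>\<^bsub>?Q\<^esub> Z = X \<oplus>\<^bsub>?Q\<^esub> (Y \<oplus>\<^bsub>?Q\<^esub> Z)"
        using x y z by (simp add: add M.M.a_assoc del: quot_mod_simps)
    qed
    show "a \<odot>\<^bsub>?Q\<^esub> X \<in> carrier ?Q" if "a \<in> carrier R" "X \<in> carrier ?Q" for a X
      using that(2) by (rule quot_mod_cases) (use that in \<open>simp add: smult quot_mod_closed del: quot_mod_simps\<close>)
    show "(a \<oplus>\<^bsub>R\<^esub> b) \<odot>\<^bsub>?Q\<^esub> X = (a \<odot>\<^bsub>?Q\<^esub> X) \<oplus>\<^bsub>?Q\<^esub> (b \<odot>\<^bsub>?Q\<^esub> X)"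
      if "a \<in> carrier R" "b \<in> carrier R" "X \<in> carrier ?Q" for a b X
      using that(3) by (rule quot_mod_cases)
        (use that in \<open>simp add: smult add M.smult_l_distr del: quot_mod_simps\<close>)
    show "a \<odot>\<^bsub>?Q\<^esub> (X \<oplus>\<^bsub>?Q\<^esub> Y) = (a \<odot>\<^bsub>?Q\<^esub> X) \<oplus>\<^bsub>?Q\<^esub> (a \<odot>\<^bsub>?Q\<^esub> Y)"
      if a: "a \<in> carrier R" and X: "X \<in> carrier ?Q" and Y: "Y \<in> carrier ?Q" for a X Y
    proof -
      from X obtain x where "x \<in> carrier M" "X = H +>\<^bsub>M\<^esub> x" by (rule quot_mod_cases)
      moreover from Y obtain y where "y \<in> carrier M" "Y = H +>\<^bsub>M\<^esub> y" by (rule quot_mod_cases)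
      ultimately show ?thesis using a by (simp add: smult add M.smult_r_distr del: quot_mod_simps)
    qed
    show "(a \<otimes>\<^bsub>R\<^esub> b) \<odot>\<^bsub>?Q\<^esub> X = a \<odot>\<^bsub>?Q\<^esub> (b \<odot>\<^bsub>?Q\<^esub> X)"
      if "a \<in> carrier R" "b \<in> carrier R" "X \<in> carrier ?Q" for a b X
      using that(3) by (rule quot_mod_cases)
        (use that in \<open>simp add: smult M.smult_assoc1 del: quot_mod_simps\<close>)
    show "\<one>\<^bsub>R\<^esub> \<odot>\<^bsub>?Q\<^esub> X = X" if "X \<in> carrier ?Q" for X
      using that by (rule quot_mod_cases) (simp add: smult del: quot_mod_simps)
  qed (rule M.R.is_cring)
qed

lemma mod_hom_zero:
  assumes "module R M" "module R N" "u \<in> mod_hom R M N"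
  shows "u \<zero>\<^bsub>M\<^esub> = \<zero>\<^bsub>N\<^esub>"
proof -
  interpret M: module R M by fact
  interpret N: module R N by fact
  have "u (\<zero>\<^bsub>R\<^esub> \<odot>\<^bsub>M\<^esub> \<zero>\<^bsub>M\<^esub>) = \<zero>\<^bsub>R\<^esub> \<odot>\<^bsub>N\<^esub> u \<zero>\<^bsub>M\<^esub>"
    by (rule mod_homD(3)[OF assms(3)]) simp_all
  then show ?thesis using mod_homD(1)[OF assms(3)] by simp
qed

lemma image_submodule:
  assumes "module R M" "module R N" "u \<in> mod_hom R M N"
  shows "submodule (u ` carrier M) R N"
proof -
  interpret M: module R M by fact
  interpret N: module R N by fact
  note u = mod_homD[OF assms(3)]
  have zero: "\<zero>\<^bsub>N\<^esub> \<in> u ` carrier M" using imageI[OF M.M.zero_closed, of u] mod_hom_zero[OF assms] by simp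
  have sm: "a \<odot>\<^bsub>N\<^esub> y \<in> u ` carrier M" if "a \<in> carrier R" "y \<in> u ` carrier M" for a y
  proof -
    from that(2) obtain x where x: "x \<in> carrier M" "y = u x" by blast
    have "u (a \<odot>\<^bsub>M\<^esub> x) \<in> u ` carrier M" using x that(1) by (intro imageI M.smult_closed)
    then show ?thesis using u(3)[OF that(1) x(1)] x(2) by simp
  qed
  have neg: "\<ominus>\<^bsub>N\<^esub> y = (\<ominus>\<^bsub>R\<^esub> \<one>\<^bsub>R\<^esub>) \<odot>\<^bsub>N\<^esub> y" if "y \<in> carrier N" for y
    using that by (simp add: N.smult_l_minus)
  show ?thesis
  proof (rule N.submoduleI)
    show "\<ominus>\<^bsub>N\<^esub> y \<in> u ` carrier M" if "y \<in> u ` carrier M" for y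
    proof -
      have y: "y \<in> carrier N" using that u(1) by blast
      show ?thesis unfolding neg[OF y] by (rule sm[OF _ that]) simp
    qed
    show "y \<oplus>\<^bsub>N\<^esub> z \<in> u ` carrier M" if "y \<in> u ` carrier M" "z \<in> u ` carrier M" for y z
    proof -
      from that obtain v w where vw: "v \<in> carrier M" "y = u v" "w \<in> carrier M" "z = u w" by blast
      have "u (v \<oplus>\<^bsub>M\<^esub> w) \<in> u ` carrier M" using vw by (intro imageI M.M.a_closed)
      then show ?thesis using u(2)[OF vw(1,3)] vw by simp
    qed
  qed (use u(1) zero sm in auto)
qed

lemma annihilator_ideal:
  assumes "module R M" "m \<in> carrier M"
  shows "ideal (annihilator R M m) R"
proof -
  interpret M: module R M by fact
  show ?thesis
  proof (rule idealI)
    show "subgroup (annihilator R M m) (add_monoid R)"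
    proof (rule M.R.add.subgroupI)
      show "annihilator R M m \<noteq> {}" using assms by (auto simp: annihilator_def intro!: exI[of _ "\<zero>\<^bsub>R\<^esub>"])
    qed (use assms in \<open>auto simp: annihilator_def M.smult_l_distr M.smult_l_minus simp flip: a_inv_def\<close>)
  next
    fix a x assume a: "a \<in> annihilator R M m" and x: "x \<in> carrier R"
    then show 1: "x \<otimes>\<^bsub>R\<^esub> a \<in> annihilator R M m"
      using assms by (auto simp: annihilator_def M.smult_assoc1)
    have "a \<otimes>\<^bsub>R\<^esub> x = x \<otimes>\<^bsub>R\<^esub> a" using a x by (auto simp: annihilator_def M.R.m_comm)
    with 1 show "a \<otimes>\<^bsub>R\<^esub> x \<in> annihilator R M m" by simp
  qed (rule M.R.ring_axioms)
qed

lemma torsion_submodule: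
  assumes "topologizing_system R \<F>" "module R M"
  shows "submodule (torsion R \<F> M) R M"
proof -
  interpret T: topologizing_system R \<F> by fact
  interpret M: module R M by fact
  have up: "x \<in> torsion R \<F> M"
    if "I \<in> \<F>" "x \<in> carrier M" "I \<subseteq> annihilator R M x" for I x
    using T.upward[OF that(1) annihilator_ideal[OF assms(2) that(2)] that(3)] that(2)
    by (simp add: torsion_def)
  show ?thesis
  proof (rule M.submoduleI)
    obtain I where I: "I \<in> \<F>" using T.nonempty by blast
    then have "I \<subseteq> carrier R" by (meson T.ideals ideal.Icarr subsetI)
    then show "\<zero>\<^bsub>M\<^esub> \<in> torsion R \<F> M" using I by (intro up) (auto simp: annihilator_def)
    fix x assume x: "x \<in> torsion R \<F> M"
    then have xc: "x \<in> carrier M" "annihilator R M x \<in> \<F>" by (auto simp: torsion_def)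
    show "\<ominus>\<^bsub>M\<^esub> x \<in> torsion R \<F> M"
      using xc by (intro up[OF xc(2)]) (auto simp: annihilator_def M.smult_r_minus)
    show "a \<odot>\<^bsub>M\<^esub> x \<in> torsion R \<F> M" if a: "a \<in> carrier R" for a
    proof (intro up[OF xc(2)])
      show "annihilator R M x \<subseteq> annihilator R M (a \<odot>\<^bsub>M\<^esub> x)"
      proof
        fix b assume b: "b \<in> annihilator R M x"
        then have "b \<odot>\<^bsub>M\<^esub> (a \<odot>\<^bsub>M\<^esub> x) = a \<odot>\<^bsub>M\<^esub> (b \<odot>\<^bsub>M\<^esub> x)"
          using a xc M.smult_assoc1[of b a x] M.smult_assoc1[of a b x] T.m_comm[of a b]
          by (simp add: annihilator_def)
        then show "b \<in> annihilator R M (a \<odot>\<^bsub>M\<^esub> x)" using b a by (simp add: annihilator_def)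
      qed
    qed (use a xc in auto)
    fix y assume y: "y \<in> torsion R \<F> M"
    then have yc: "y \<in> carrier M" "annihilator R M y \<in> \<F>" by (auto simp: torsion_def)
    show "x \<oplus>\<^bsub>M\<^esub> y \<in> torsion R \<F> M"
      using xc yc by (intro up[OF T.inter[OF xc(2) yc(2)]]) (auto simp: annihilator_def M.smult_r_distr)
  qed (auto simp: torsion_def)
qed

lemma torsion_mono:
  assumes "topologizing_system R \<F>" "module R M" "module R N" "u \<in> mod_hom R M N"
    and "x \<in> torsion R \<F> M"
  shows "u x \<in> torsion R \<F> N"
proof -
  interpret T: topologizing_system R \<F> by fact
  have x: "x \<in> carrier M" "annihilator R M x \<in> \<F>" using assms(5) by (auto simp: torsion_def)
  have "annihilator R M x \<subseteq> annihilator R N (u x)"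
    using x by (auto simp: annihilator_def mod_hom_zero[OF assms(2-4)] simp flip: mod_homD(3)[OF assms(4)])
  moreover have "ideal (annihilator R N (u x)) R"
    using x by (intro annihilator_ideal mod_homD(1)[OF assms(4)] assms)
  ultimately show ?thesis
    using T.upward x mod_homD(1)[OF assms(4)] by (auto simp: torsion_def)
qed

lemma quot_map_coset:
  assumes "module R M" "module R N" "submodule H R M" "submodule K R N"
    and "u \<in> mod_hom R M N" "u ` H \<subseteq> K" "x \<in> carrier M"
  shows "quot_map N K u (H +>\<^bsub>M\<^esub> x) = K +>\<^bsub>N\<^esub> u x"
proof -
  interpret H: abelian_subgroup H M using submodule_abelian_subgroup assms by blast
  interpret K: abelian_subgroup K N using submodule_abelian_subgroup assms by blast
  note u = mod_homD[OF assms(5)]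
  have "K +>\<^bsub>N\<^esub> u y = K +>\<^bsub>N\<^esub> u x" if "y \<in> H +>\<^bsub>M\<^esub> x" for y
  proof -
    obtain h where h: "h \<in> H" "y = h \<oplus>\<^bsub>M\<^esub> x" using \<open>y \<in> _\<close> by (auto simp: a_r_coset_def')
    then have "u y = u h \<oplus>\<^bsub>N\<^esub> u x" using u(2) assms H.a_Hcarr by auto
    then have "u y \<in> K +>\<^bsub>N\<^esub> u x" using h assms(6) by (auto simp: a_r_coset_def')
    then show ?thesis using u(1) assms by (intro K.a_repr_independence'[symmetric]) auto
  qed
  moreover have "x \<in> H +>\<^bsub>M\<^esub> x" using assms H.a_rcos_self by blast
  ultimately show ?thesis
    unfolding quot_map_def by (intro SUP_eq_const) blast+
qed

lemma quot_map_mod_hom: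
  assumes "module R M" "module R N" "submodule H R M" "submodule K R N"
    and "u \<in> mod_hom R M N" "u ` H \<subseteq> K"
  shows "quot_map N K u \<in> mod_hom R (quot_mod M H) (quot_mod N K)"
proof -
  interpret M: module R M by fact
  note u = mod_homD[OF assms(5)] and q = quot_map_coset[OF assms]
  show ?thesis
  proof (rule mod_homI)
    fix X assume "X \<in> carrier (quot_mod M H)"
    then obtain x where x: "x \<in> carrier M" "X = H +>\<^bsub>M\<^esub> x" by (rule quot_mod_cases)
    show "quot_map N K u X \<in> carrier (quot_mod N K)"
      unfolding x(2) q[OF x(1)] by (rule quot_mod_closed[OF u(1)[OF x(1)]])
    show "quot_map N K u (a \<odot>\<^bsub>quot_mod M H\<^esub> X) = a \<odot>\<^bsub>quot_mod N K\<^esub> quot_map N K u X"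
      if "a \<in> carrier R" for a
      unfolding x(2) quot_mod_smult[OF assms(1,3) that x(1)] q[OF x(1)]
        quot_mod_smult[OF assms(2,4) that u(1)[OF x(1)]] q[OF M.smult_closed[OF that x(1)]]
        u(3)[OF that x(1)] by (rule refl)
    fix Y assume "Y \<in> carrier (quot_mod M H)"
    then obtain y where y: "y \<in> carrier M" "Y = H +>\<^bsub>M\<^esub> y" by (rule quot_mod_cases)
    show "quot_map N K u (X \<oplus>\<^bsub>quot_mod M H\<^esub> Y) = quot_map N K u X \<oplus>\<^bsub>quot_mod N K\<^esub> quot_map N K u Y"
      unfolding x(2) y(2) quot_mod_add[OF assms(1,3) x(1) y(1)] q[OF x(1)] q[OF y(1)]
        quot_mod_add[OF assms(2,4) u(1)[OF x(1)] u(1)[OF y(1)]] q[OF M.M.a_closed[OF x(1) y(1)]]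
        u(2)[OF x(1) y(1)] by (rule refl)
  qed
qed

lemma mod_hom_compose:
  assumes f: "f \<in> mod_hom R L M" and g: "g \<in> mod_hom R M N"
  shows "(\<lambda>x. g (f x)) \<in> mod_hom R L N"
  by (rule mod_homI) (simp_all add: mod_homD[OF f] mod_homD[OF g])

context topologizing_system
begin

lemma carrier_mem: "carrier R \<in> \<F>"
proof -
  obtain I where I: "I \<in> \<F>" using nonempty by blast
  then have "I \<subseteq> carrier R" by (meson ideals ideal.Icarr subsetI)
  then show ?thesis using upward[OF I oneideal] by blast
qed

lemma mem_subset: "I \<in> \<F> \<Longrightarrow> I \<subseteq> carrier R"
  by (meson ideals ideal.Icarr subsetI)

lemma ideal_ops:
  assumes "I \<in> \<F>" "x \<in> I"
  shows "y \<in> I \<Longrightarrow> x \<oplus> y \<in> I" and "a \<in> carrier R \<Longrightarrow> a \<otimes> x \<in> I"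
  using ideals[OF assms(1)] assms(2)
  by (auto intro: ideal.I_l_closed additive_subgroup.a_closed ideal.axioms(1))

lemma loc_preI:
  assumes "I \<in> \<F>" "f \<in> mod_hom R (ideal_mod R I) (quot_mod M (torsion R \<F> M))"
  shows "(I, restrict f I) \<in> loc_pre R \<F> M"
  using assms ideal_ops[OF assms(1)]
  by (auto simp: loc_pre_def intro!: mod_homI simp: mod_homD[OF assms(2), simplified])

lemma mod_hom_subset:
  assumes "f \<in> mod_hom R (ideal_mod R I) Q" "J \<subseteq> I"
  shows "f \<in> mod_hom R (ideal_mod R J) Q"
  using assms(2) by (intro mod_homI) (auto simp: mod_homD[OF assms(1), simplified] subsetD)

lemma loc_rel_iff:
  "((I, f), (J, g)) \<in> loc_rel R \<F> M \<longleftrightarrow> (I, f) \<in> loc_pre R \<F> M \<and> (J, g) \<in> loc_pre R \<F> M \<and>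
    (\<exists>K \<in> \<F>. K \<subseteq> I \<inter> J \<and> (\<forall>x \<in> K. f x = g x))"
proof -
  have "restrict f K = restrict g K \<longleftrightarrow> (\<forall>x \<in> K. f x = g x)" for K
    by (metis restrict_apply' restrict_ext)
  then show ?thesis by (simp add: loc_rel_def)
qed

lemma loc_rel_equiv: "equiv (loc_pre R \<F> M) (loc_rel R \<F> M)"
proof (rule equivI)
  show "loc_rel R \<F> M \<subseteq> loc_pre R \<F> M \<times> loc_pre R \<F> M"
    by (auto simp: loc_rel_def)
  show "refl_on (loc_pre R \<F> M) (loc_rel R \<F> M)"
  proof (rule refl_onI)
    fix p assume p: "p \<in> loc_pre R \<F> M"
    obtain I f where "p = (I, f)" by (cases p)
    moreover have "I \<in> \<F>" using p \<open>p = _\<close> by (auto simp: loc_pre_def)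
    ultimately show "(p, p) \<in> loc_rel R \<F> M" using p by (auto simp: loc_rel_iff)
  qed
  show "sym (loc_rel R \<F> M)"
  proof (rule symI)
    fix p q assume pq: "(p, q) \<in> loc_rel R \<F> M"
    obtain I f J g where e: "p = (I, f)" "q = (J, g)" by (metis surj_pair)
    obtain K where K: "K \<in> \<F>" "K \<subseteq> I \<inter> J" "\<forall>x \<in> K. f x = g x"
      using pq unfolding e loc_rel_iff by blast
    have "\<forall>x \<in> K. g x = f x" "K \<subseteq> J \<inter> I" using K by auto
    then show "(q, p) \<in> loc_rel R \<F> M" using pq K(1) unfolding e loc_rel_iff by blast
  qed
  show "trans (loc_rel R \<F> M)"
  proof (rule transI)
    fix p q r assume pq: "(p, q) \<in> loc_rel R \<F> M" and qr: "(q, r) \<in> loc_rel R \<F> M"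
    obtain I f J g L h where e: "p = (I, f)" "q = (J, g)" "r = (L, h)"
      by (metis surj_pair)
    obtain A where A: "A \<in> \<F>" "A \<subseteq> I \<inter> J" "\<forall>x \<in> A. f x = g x"
      using pq unfolding e loc_rel_iff by blast
    obtain B where B: "B \<in> \<F>" "B \<subseteq> J \<inter> L" "\<forall>x \<in> B. g x = h x"
      using qr unfolding e loc_rel_iff by blast
    have "A \<inter> B \<subseteq> I \<inter> L" "\<forall>x \<in> A \<inter> B. f x = h x" using A B by auto
    then show "(p, r) \<in> loc_rel R \<F> M"
      using inter[OF A(1) B(1)] pq qr unfolding e loc_rel_iff by blast
  qed
qed

lemma loc_class_eq_iff:
  assumes "(I, f) \<in> loc_pre R \<F> M" "(J, g) \<in> loc_pre R \<F> M"
  shows "loc_class R \<F> M I f = loc_class R \<F> M J g \<longleftrightarrow>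
    (\<exists>K \<in> \<F>. K \<subseteq> I \<inter> J \<and> (\<forall>x \<in> K. f x = g x))"
proof -
  have "loc_class R \<F> M I f = loc_class R \<F> M J g \<longleftrightarrow> ((I, f), (J, g)) \<in> loc_rel R \<F> M"
    unfolding loc_class_def by (rule eq_equiv_class_iff[OF loc_rel_equiv assms])
  then show ?thesis unfolding loc_rel_iff using assms by blast
qed

lemma loc_class_mem_iff:
  "(J, g) \<in> loc_class R \<F> M I f \<longleftrightarrow> (I, f) \<in> loc_pre R \<F> M \<and> (J, g) \<in> loc_pre R \<F> M \<and>
    (\<exists>K \<in> \<F>. K \<subseteq> I \<inter> J \<and> (\<forall>x \<in> K. f x = g x))"
  by (simp add: loc_class_def Image_singleton_iff loc_rel_iff)

lemma localization_cases:
  assumes "X \<in> carrier (localization R \<F> M)"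
  obtains I f where "(I, f) \<in> loc_pre R \<F> M" "X = loc_class R \<F> M I f"
  using assms by (auto simp: localization_def Let_def quotient_def loc_class_def)

lemma localization_closed:
  "(I, f) \<in> loc_pre R \<F> M \<Longrightarrow> loc_class R \<F> M I f \<in> carrier (localization R \<F> M)"
  by (auto simp: localization_def Let_def quotient_def loc_class_def)

lemma UN_class:
  assumes "(I, f) \<in> loc_pre R \<F> M"
    and "\<And>J g. \<lbrakk>(J, g) \<in> loc_pre R \<F> M; (J, g) \<in> loc_class R \<F> M I f\<rbrakk> \<Longrightarrow> F J g = F I f"
  shows "(\<Union>(J, g) \<in> loc_class R \<F> M I f. F J g) = F I f"
proof -
  have "(I, f) \<in> loc_class R \<F> M I f"
    unfolding loc_class_def by (rule equiv_class_self[OF loc_rel_equiv assms(1)])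
  moreover have "F J g = F I f" if "(J, g) \<in> loc_class R \<F> M I f" for J g
    using assms(2) that by (auto simp: loc_class_mem_iff)
  ultimately show ?thesis by fast
qed

lemma loc_pre_add:
  assumes "module R M" "(I, f) \<in> loc_pre R \<F> M" "(J, g) \<in> loc_pre R \<F> M"
  shows "(I \<inter> J, \<lambda>x \<in> I \<inter> J. f x \<oplus>\<^bsub>quot_mod M (torsion R \<F> M)\<^esub> g x) \<in> loc_pre R \<F> M"
proof -
  let ?Q = "quot_mod M (torsion R \<F> M)"
  interpret Q: module R ?Q
    using assms torsion_submodule quot_mod_module topologizing_system_axioms by blast
  have f: "I \<in> \<F>" "f \<in> mod_hom R (ideal_mod R I) ?Q" and g: "J \<in> \<F>" "g \<in> mod_hom R (ideal_mod R J) ?Q"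
    using assms by (auto simp: loc_pre_def)
  note fD = mod_homD[OF f(2), unfolded ideal_mod_simps]
    and gD = mod_homD[OF g(2), unfolded ideal_mod_simps]
  show ?thesis
    by (intro loc_preI inter f g mod_homI)
      (auto simp: fD gD Q.M.a_ac Q.smult_r_distr simp del: quot_mod_simps)
qed

lemma loc_pre_smult:
  assumes "module R M" "(I, f) \<in> loc_pre R \<F> M" "a \<in> carrier R"
  shows "(I, \<lambda>x \<in> I. a \<odot>\<^bsub>quot_mod M (torsion R \<F> M)\<^esub> f x) \<in> loc_pre R \<F> M"
proof -
  let ?Q = "quot_mod M (torsion R \<F> M)"
  interpret Q: module R ?Q
    using assms torsion_submodule quot_mod_module topologizing_system_axioms by blast
  have f: "I \<in> \<F>" "f \<in> mod_hom R (ideal_mod R I) ?Q"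
    using assms by (auto simp: loc_pre_def)
  note fD = mod_homD[OF f(2), unfolded ideal_mod_simps]
  show ?thesis
    by (intro loc_preI f mod_homI)
      (use assms in \<open>auto simp: fD Q.smult_r_distr m_comm simp del: quot_mod_simps simp flip: Q.smult_assoc1\<close>)
qed

lemma loc_pre_zero:
  assumes "module R M"
  shows "(carrier R, \<lambda>x \<in> carrier R. \<zero>\<^bsub>quot_mod M (torsion R \<F> M)\<^esub>) \<in> loc_pre R \<F> M"
proof -
  let ?Q = "quot_mod M (torsion R \<F> M)"
  interpret Q: module R ?Q
    using assms torsion_submodule quot_mod_module topologizing_system_axioms by blast
  show ?thesis
    by (intro loc_preI carrier_mem mod_homI) (auto simp del: quot_mod_simps)
qed

lemma loc_pre_map:
  assumes "module R M" "module R N" "u \<in> mod_hom R M N" "(I, f) \<in> loc_pre R \<F> M"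
  shows "(I, \<lambda>x \<in> I. quot_map N (torsion R \<F> N) u (f x)) \<in> loc_pre R \<F> N"
proof -
  have "quot_map N (torsion R \<F> N) u \<in>
      mod_hom R (quot_mod M (torsion R \<F> M)) (quot_mod N (torsion R \<F> N))"
    using torsion_mono[OF topologizing_system_axioms assms(1-3)]
    by (intro quot_map_mod_hom torsion_submodule topologizing_system_axioms assms) auto
  moreover have "I \<in> \<F>" "f \<in> mod_hom R (ideal_mod R I) (quot_mod M (torsion R \<F> M))"
    using assms(4) by (auto simp: loc_pre_def)
  ultimately show ?thesis
    using loc_preI[OF _ mod_hom_compose] by blast
qed

lemma localization_add:
  assumes "module R M" "(I, f) \<in> loc_pre R \<F> M" "(J, g) \<in> loc_pre R \<F> M"
  shows "loc_class R \<F> M I f \<oplus>\<^bsub>localization R \<F> M\<^esub> loc_class R \<F> M J g =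
    loc_class R \<F> M (I \<inter> J) (\<lambda>x \<in> I \<inter> J. f x \<oplus>\<^bsub>quot_mod M (torsion R \<F> M)\<^esub> g x)"
proof -
  let ?Q = "quot_mod M (torsion R \<F> M)"
  let ?C = "\<lambda>I f J g. loc_class R \<F> M (I \<inter> J) (\<lambda>x \<in> I \<inter> J. f x \<oplus>\<^bsub>?Q\<^esub> g x)"
  have eq: "?C I' f' J' g' = ?C I f J g"
    if "(I', f') \<in> loc_class R \<F> M I f" "(J', g') \<in> loc_class R \<F> M J g" for I' f' J' g'
  proof -
    from that obtain A B where A: "A \<in> \<F>" "A \<subseteq> I \<inter> I'" "\<And>x. x \<in> A \<Longrightarrow> f x = f' x"
      and B: "B \<in> \<F>" "B \<subseteq> J \<inter> J'" "\<And>x. x \<in> B \<Longrightarrow> g x = g' x"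
      and p: "(I', f') \<in> loc_pre R \<F> M" "(J', g') \<in> loc_pre R \<F> M"
      by (auto simp: loc_class_mem_iff)
    show ?thesis
      unfolding loc_class_eq_iff[OF loc_pre_add[OF assms(1) p] loc_pre_add[OF assms]]
      using A B by (intro bexI[OF _ inter[OF A(1) B(1)]]) (auto simp: subset_iff simp del: quot_mod_simps)
  qed
  have self: "(I, f) \<in> loc_class R \<F> M I f" "(J, g) \<in> loc_class R \<F> M J g"
    using assms by (auto simp: loc_class_mem_iff loc_pre_def)
  have "loc_class R \<F> M I f \<oplus>\<^bsub>localization R \<F> M\<^esub> loc_class R \<F> M J g =
      (\<Union>(I', f') \<in> loc_class R \<F> M I f. \<Union>(J', g') \<in> loc_class R \<F> M J g. ?C I' f' J' g')"
    by (simp add: localization_def Let_def)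
  also have "\<dots> = (\<Union>(I', f') \<in> loc_class R \<F> M I f. ?C I' f' J g)"
    by (intro SUP_cong refl) (auto simp del: quot_mod_simps intro!: UN_class assms(3) simp: eq[OF _ self(2)] eq)
  also have "\<dots> = ?C I f J g"
    by (rule UN_class[OF assms(2)]) (rule eq[OF _ self(2)])
  finally show ?thesis .
qed

lemma localization_smult:
  assumes "module R M" "(I, f) \<in> loc_pre R \<F> M" "a \<in> carrier R"
  shows "a \<odot>\<^bsub>localization R \<F> M\<^esub> loc_class R \<F> M I f =
    loc_class R \<F> M I (\<lambda>x \<in> I. a \<odot>\<^bsub>quot_mod M (torsion R \<F> M)\<^esub> f x)"
proof -
  let ?Q = "quot_mod M (torsion R \<F> M)"
  have "loc_class R \<F> M J (\<lambda>x \<in> J. a \<odot>\<^bsub>?Q\<^esub> g x) = loc_class R \<F> M I (\<lambda>x \<in> I. a \<odot>\<^bsub>?Q\<^esub> f x)"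
    if "(J, g) \<in> loc_pre R \<F> M" "(J, g) \<in> loc_class R \<F> M I f" for J g
  proof -
    from that(2) obtain K where K: "K \<in> \<F>" "K \<subseteq> I \<inter> J" "\<forall>x \<in> K. f x = g x"
      unfolding loc_class_mem_iff by blast
    show ?thesis
      unfolding loc_class_eq_iff[OF loc_pre_smult[OF assms(1) that(1) assms(3)] loc_pre_smult[OF assms]]
      using K by (intro bexI[OF _ K(1)]) (auto simp: subset_iff)
  qed
  then show ?thesis
    using UN_class[OF assms(2), of "\<lambda>I f. loc_class R \<F> M I (\<lambda>x \<in> I. a \<odot>\<^bsub>?Q\<^esub> f x)"]
    by (simp add: localization_def Let_def)
qed

lemma localization_map_class:
  assumes "module R M" "module R N" "u \<in> mod_hom R M N" "(I, f) \<in> loc_pre R \<F> M"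
  shows "localization_map R \<F> M N u (loc_class R \<F> M I f) =
    loc_class R \<F> N I (\<lambda>x \<in> I. quot_map N (torsion R \<F> N) u (f x))"
  unfolding localization_map_def
proof (rule UN_class[OF assms(4)])
  fix J g assume J: "(J, g) \<in> loc_pre R \<F> M" "(J, g) \<in> loc_class R \<F> M I f"
  show "loc_class R \<F> N J (\<lambda>x \<in> J. quot_map N (torsion R \<F> N) u (g x)) =
      loc_class R \<F> N I (\<lambda>x \<in> I. quot_map N (torsion R \<F> N) u (f x))"
  proof -
    from J(2) obtain K where K: "K \<in> \<F>" "K \<subseteq> I \<inter> J" "\<forall>x \<in> K. f x = g x"
      unfolding loc_class_mem_iff by blast
    show ?thesis
      unfolding loc_class_eq_iff[OF loc_pre_map[OF assms(1-3) J(1)] loc_pre_map[OF assms]]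
      using K by (intro bexI[OF _ K(1)]) (auto simp: subset_iff)
  qed
qed

lemma localization_module:
  assumes "module R M"
  shows "module R (localization R \<F> M)"
proof -
  let ?Q = "quot_mod M (torsion R \<F> M)" and ?L = "localization R \<F> M"
  interpret Q: module R ?Q
    using assms torsion_submodule quot_mod_module topologizing_system_axioms by blast
  have val: "f x \<in> carrier ?Q" if "(I, f) \<in> loc_pre R \<F> M" "x \<in> I" for I f x
    using that mod_homD(1)[of f R "ideal_mod R I" ?Q x] by (auto simp: loc_pre_def)
  have mem: "I \<in> \<F>" if "(I, f) \<in> loc_pre R \<F> M" for I f
    using that by (auto simp: loc_pre_def)
  have zero: "\<zero>\<^bsub>?L\<^esub> = loc_class R \<F> M (carrier R) (\<lambda>x \<in> carrier R. \<zero>\<^bsub>?Q\<^esub>)"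
    by (simp add: localization_def Let_def)
  have eqI: "loc_class R \<F> M I f = loc_class R \<F> M J g"
    if "(I, f) \<in> loc_pre R \<F> M" "(J, g) \<in> loc_pre R \<F> M" "\<And>x. \<lbrakk>x \<in> I; x \<in> J\<rbrakk> \<Longrightarrow> f x = g x"
    for I f J g
    unfolding loc_class_eq_iff[OF that(1,2)]
    using that by (intro bexI[OF _ inter[OF mem[OF that(1)] mem[OF that(2)]]]) auto
  note pre = loc_pre_add[OF assms] loc_pre_smult[OF assms] loc_pre_zero[OF assms]
  note ops = localization_add[OF assms] localization_smult[OF assms] zero
  show ?thesis
  proof (rule moduleI)
    show "abelian_group ?L"
    proof (rule abelian_groupI)
      show "\<zero>\<^bsub>?L\<^esub> \<in> carrier ?L" using pre(3) by (simp only: zero localization_closed)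
      fix X assume "X \<in> carrier ?L"
      then obtain I f where X: "(I, f) \<in> loc_pre R \<F> M" "X = loc_class R \<F> M I f"
        by (rule localization_cases)
      note IR = mem_subset[OF mem[OF X(1)]]
      show "\<zero>\<^bsub>?L\<^esub> \<oplus>\<^bsub>?L\<^esub> X = X"
        unfolding X(2) ops(1)[OF pre(3) X(1)] zero
        by (rule eqI[OF pre(1)[OF pre(3) X(1)] X(1)]) (use X in \<open>auto simp: val simp del: quot_mod_simps\<close>)
      show "\<exists>Y\<in>carrier ?L. Y \<oplus>\<^bsub>?L\<^esub> X = \<zero>\<^bsub>?L\<^esub>"
      proof
        have m1: "\<ominus> \<one> \<in> carrier R" by simp
        let ?Y = "loc_class R \<F> M I (\<lambda>x \<in> I. (\<ominus> \<one>) \<odot>\<^bsub>?Q\<^esub> f x)"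
        show "?Y \<in> carrier ?L" by (rule localization_closed[OF pre(2)[OF X(1) m1]])
        show "?Y \<oplus>\<^bsub>?L\<^esub> X = \<zero>\<^bsub>?L\<^esub>"
          unfolding X(2) ops(1)[OF pre(2)[OF X(1) m1] X(1)] zero
          by (rule eqI[OF pre(1)[OF pre(2)[OF X(1) m1] X(1)] pre(3)])
            (use X in \<open>auto simp: val Q.smult_l_minus Q.M.l_neg simp del: quot_mod_simps\<close>)
      qed
      fix Y assume "Y \<in> carrier ?L"
      then obtain J g where Y: "(J, g) \<in> loc_pre R \<F> M" "Y = loc_class R \<F> M J g"
        by (rule localization_cases)
      show "X \<oplus>\<^bsub>?L\<^esub> Y \<in> carrier ?L"
        unfolding X(2) Y(2) ops(1)[OF X(1) Y(1)] by (rule localization_closed[OF pre(1)[OF X(1) Y(1)]])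
      show "X \<oplus>\<^bsub>?L\<^esub> Y = Y \<oplus>\<^bsub>?L\<^esub> X"
        unfolding X(2) Y(2) ops(1)[OF X(1) Y(1)] ops(1)[OF Y(1) X(1)]
        by (rule eqI[OF pre(1)[OF X(1) Y(1)] pre(1)[OF Y(1) X(1)]])
          (use X Y in \<open>auto simp: val Q.M.a_comm simp del: quot_mod_simps\<close>)
      fix Z assume "Z \<in> carrier ?L"
      then obtain K h where Z: "(K, h) \<in> loc_pre R \<F> M" "Z = loc_class R \<F> M K h"
        by (rule localization_cases)
      show "X \<oplus>\<^bsub>?L\<^esub> Y \<oplus>\<^bsub>?L\<^esub> Z = X \<oplus>\<^bsub>?L\<^esub> (Y \<oplus>\<^bsub>?L\<^esub> Z)"
        unfolding X(2) Y(2) Z(2) ops(1)[OF X(1) Y(1)] ops(1)[OF Y(1) Z(1)]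
          ops(1)[OF pre(1)[OF X(1) Y(1)] Z(1)] ops(1)[OF X(1) pre(1)[OF Y(1) Z(1)]]
        by (rule eqI[OF pre(1)[OF pre(1)[OF X(1) Y(1)] Z(1)] pre(1)[OF X(1) pre(1)[OF Y(1) Z(1)]]])
          (use X Y Z in \<open>auto simp: val Q.M.a_assoc simp del: quot_mod_simps\<close>)
    qed
  next
    fix a X assume a: "a \<in> carrier R" and "X \<in> carrier ?L"
    then obtain I f where X: "(I, f) \<in> loc_pre R \<F> M" "X = loc_class R \<F> M I f"
      by (metis localization_cases)
    show "a \<odot>\<^bsub>?L\<^esub> X \<in> carrier ?L"
      unfolding X(2) ops(2)[OF X(1) a] by (rule localization_closed[OF pre(2)[OF X(1) a]])
  next
    fix a b X assume a: "a \<in> carrier R" and b: "b \<in> carrier R" and "X \<in> carrier ?L"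
    then obtain I f where X: "(I, f) \<in> loc_pre R \<F> M" "X = loc_class R \<F> M I f"
      by (metis localization_cases)
    have ab: "a \<oplus> b \<in> carrier R" "a \<otimes> b \<in> carrier R" using a b by auto
    note pa = pre(2)[OF X(1) a] and pb = pre(2)[OF X(1) b]
    show "(a \<oplus> b) \<odot>\<^bsub>?L\<^esub> X = a \<odot>\<^bsub>?L\<^esub> X \<oplus>\<^bsub>?L\<^esub> b \<odot>\<^bsub>?L\<^esub> X"
      unfolding X(2) ops(2)[OF X(1) a] ops(2)[OF X(1) b] ops(2)[OF X(1) ab(1)] ops(1)[OF pa pb]
      by (rule eqI[OF pre(2)[OF X(1) ab(1)] pre(1)[OF pa pb]])
        (use X a b in \<open>auto simp: val Q.smult_l_distr simp del: quot_mod_simps\<close>)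
    show "(a \<otimes> b) \<odot>\<^bsub>?L\<^esub> X = a \<odot>\<^bsub>?L\<^esub> (b \<odot>\<^bsub>?L\<^esub> X)"
      unfolding X(2) ops(2)[OF X(1) b] ops(2)[OF X(1) ab(2)] ops(2)[OF pb a]
      by (rule eqI[OF pre(2)[OF X(1) ab(2)] pre(2)[OF pb a]])
        (use X a b in \<open>auto simp: val Q.smult_assoc1 simp del: quot_mod_simps\<close>)
  next
    fix a X Y assume a: "a \<in> carrier R" and "X \<in> carrier ?L" "Y \<in> carrier ?L"
    then obtain I f J g where X: "(I, f) \<in> loc_pre R \<F> M" "X = loc_class R \<F> M I f"
      and Y: "(J, g) \<in> loc_pre R \<F> M" "Y = loc_class R \<F> M J g"
      by (metis localization_cases)
    note pX = pre(2)[OF X(1) a] and pY = pre(2)[OF Y(1) a] and pXY = pre(1)[OF X(1) Y(1)]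
    show "a \<odot>\<^bsub>?L\<^esub> (X \<oplus>\<^bsub>?L\<^esub> Y) = a \<odot>\<^bsub>?L\<^esub> X \<oplus>\<^bsub>?L\<^esub> a \<odot>\<^bsub>?L\<^esub> Y"
      unfolding X(2) Y(2) ops(1)[OF X(1) Y(1)] ops(2)[OF X(1) a] ops(2)[OF Y(1) a]
        ops(2)[OF pXY a] ops(1)[OF pX pY]
      by (rule eqI[OF pre(2)[OF pXY a] pre(1)[OF pX pY]])
        (use X Y a in \<open>auto simp: val Q.smult_r_distr simp del: quot_mod_simps\<close>)
  next
    fix X assume "X \<in> carrier ?L"
    then obtain I f where X: "(I, f) \<in> loc_pre R \<F> M" "X = loc_class R \<F> M I f"
      by (metis localization_cases)
    show "\<one> \<odot>\<^bsub>?L\<^esub> X = X"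
      unfolding X(2) ops(2)[OF X(1) one_closed]
      by (rule eqI[OF pre(2)[OF X(1) one_closed] X(1)]) (use X in \<open>auto simp: val simp del: quot_mod_simps\<close>)
  qed (rule is_cring)
qed

end

end

theory Submission
  imports Defs
begin

text \<open>
  Write \<open>\<phi>'\<close> for the map \<open>M / \<F>(M) \<rightarrow> N / \<F>(N)\<close> induced by \<open>\<phi>\<close>. Idempotence enters through one
  consequence: an ideal \<open>I \<subseteq> J\<close> with \<open>J \<in> \<F>\<close> lies in \<open>\<F>\<close> as soon as every \<open>x \<in> J\<close> is carried into
  \<open>I\<close> by some member of \<open>\<F>\<close> (\<open>idempotent_memI\<close>). It is used twice.

  First, it makes \<open>\<F>\<close>-torsion closed under extensions: if a member of \<open>\<F>\<close> carries \<open>m\<close> into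
  \<open>\<F>(M)\<close>, then \<open>m \<in> \<F>(M)\<close>. If \<open>\<phi> m\<close> is torsion, its annihilator carries \<open>m\<close> into the kernel of
  \<open>\<phi>\<close>, which is torsion, so \<open>m\<close> is torsion: \<open>\<phi>'\<close> is injective. Two
  homomorphisms into \<open>M / \<F>(M)\<close> whose composites with \<open>\<phi>'\<close> agree on a member of \<open>\<F>\<close> therefore
  agree there themselves, and the localized map is injective.

  Second, given \<open>g : I \<rightarrow> N / \<F>(N)\<close>, consider the ideal \<open>K\<close> of those \<open>x \<in> I\<close> for which \<open>g x\<close> lies
  in the image of \<open>\<phi>'\<close>. As the cokernel of \<open>\<phi>\<close> is negligible, a representative of \<open>g x\<close> is
  carried into the image of \<open>\<phi>\<close> by a member of \<open>\<F>\<close>, which then carries \<open>x\<close> into \<open>K\<close>. So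
  \<open>K \<in> \<F>\<close>, and on \<open>K\<close> the homomorphism \<open>g\<close> factors through the injective \<open>\<phi>'\<close>. The factor
  represents a preimage of the class of \<open>g\<close>.
\<close>

section \<open>Quotients and homomorphisms of modules\<close>

lemma coset_eq_iff_mem:
  assumes "module R M" "submodule H R M" "x \<in> carrier M"
  shows "H +>\<^bsub>M\<^esub> x = H \<longleftrightarrow> x \<in> H"
proof -
  interpret M: module R M by fact
  interpret H: abelian_subgroup H M using submodule_abelian_subgroup assms by blast
  show ?thesis
    using H.a_rcos_self[OF assms(3)] H.a_rcos_const[of x] by auto
qed

lemma annihilator_coset:
  assumes "module R M" "submodule H R M" "x \<in> carrier M"
  shows "annihilator R (quot_mod M H) (H +>\<^bsub>M\<^esub> x) = {a \<in> carrier R. a \<odot>\<^bsub>M\<^esub> x \<in> H}"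
proof -
  interpret M: module R M by fact
  have "a \<odot>\<^bsub>quot_mod M H\<^esub> (H +>\<^bsub>M\<^esub> x) = H \<longleftrightarrow> a \<odot>\<^bsub>M\<^esub> x \<in> H" if a: "a \<in> carrier R" for a
    unfolding quot_mod_smult[OF assms(1,2) a assms(3)]
    by (rule coset_eq_iff_mem[OF assms(1,2) M.smult_closed[OF a assms(3)]])
  then show ?thesis
    by (auto simp: annihilator_def)
qed

lemma ideal_preimage_submodule:
  assumes "cring R" "ideal I R" "module R Q" "submodule P R Q"
    and f: "f \<in> mod_hom R (ideal_mod R I) Q"
  shows "ideal {x \<in> I. f x \<in> P} R"
proof -
  interpret R: cring R by fact
  interpret I: ideal I R by fact
  interpret P: submodule P R Q by fact
  note fD = mod_homD[OF f, unfolded ideal_mod_simps]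
  have f0: "f \<zero>\<^bsub>R\<^esub> = \<zero>\<^bsub>Q\<^esub>"
    using mod_hom_zero[OF ideal_mod_module[OF assms(1,2)] assms(3) f] by simp
  have smult: "a \<otimes>\<^bsub>R\<^esub> x \<in> {x \<in> I. f x \<in> P}"
    if "a \<in> carrier R" "x \<in> {x \<in> I. f x \<in> P}" for a x
    using that I.I_l_closed by (auto simp: fD)
  show ?thesis
  proof (rule idealI)
    show "subgroup {x \<in> I. f x \<in> P} (add_monoid R)"
    proof (rule R.add.subgroupI)
      show "{x \<in> I. f x \<in> P} \<noteq> {}"
        using f0 P.one_closed by (auto intro!: exI[of _ "\<zero>\<^bsub>R\<^esub>"])
    next
      fix x assume x: "x \<in> {x \<in> I. f x \<in> P}"
      have "\<ominus>\<^bsub>R\<^esub> x = (\<ominus>\<^bsub>R\<^esub> \<one>\<^bsub>R\<^esub>) \<otimes>\<^bsub>R\<^esub> x"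
        using x I.a_Hcarr by (simp add: R.l_minus)
      then show "\<ominus>\<^bsub>R\<^esub> x \<in> {x \<in> I. f x \<in> P}"
        using smult[OF _ x, of "\<ominus>\<^bsub>R\<^esub> \<one>\<^bsub>R\<^esub>"] by simp
    next
      show "x \<oplus>\<^bsub>R\<^esub> y \<in> {x \<in> I. f x \<in> P}"
        if "x \<in> {x \<in> I. f x \<in> P}" "y \<in> {x \<in> I. f x \<in> P}" for x y
        using that P.m_closed by (auto simp: fD)
    qed (auto intro: I.a_Hcarr)
  next
    fix x a assume "x \<in> {x \<in> I. f x \<in> P}" "a \<in> carrier R"
    then show "a \<otimes>\<^bsub>R\<^esub> x \<in> {x \<in> I. f x \<in> P}" "x \<otimes>\<^bsub>R\<^esub> a \<in> {x \<in> I. f x \<in> P}"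
      using smult[of a x] R.m_comm[of x a] I.a_Hcarr[of x] by auto
  qed (rule R.ring_axioms)
qed

lemma mod_hom_inv_into:
  assumes "module R L" "module R Q"
    and g: "g \<in> mod_hom R L N" and v: "v \<in> mod_hom R Q N"
    and inj: "inj_on v (carrier Q)" and image: "g ` carrier L \<subseteq> v ` carrier Q"
  shows "(\<lambda>x. inv_into (carrier Q) v (g x)) \<in> mod_hom R L Q"
proof -
  interpret L: module R L by fact
  interpret Q: module R Q by fact
  let ?f = "\<lambda>x. inv_into (carrier Q) v (g x)"
  note gD = mod_homD[OF g] and vD = mod_homD[OF v]
  have f: "?f x \<in> carrier Q" "v (?f x) = g x" if "x \<in> carrier L" for x
    using subsetD[OF image imageI[OF that]] by (auto intro: inv_into_into f_inv_into_f)
  show ?thesis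
  proof (rule mod_homI)
    show "?f (x \<oplus>\<^bsub>L\<^esub> y) = ?f x \<oplus>\<^bsub>Q\<^esub> ?f y" if "x \<in> carrier L" "y \<in> carrier L" for x y
      by (rule inj_onD[OF inj]) (use that f[of "x \<oplus>\<^bsub>L\<^esub> y"] in \<open>simp_all add: f gD vD\<close>)
    show "?f (a \<odot>\<^bsub>L\<^esub> x) = a \<odot>\<^bsub>Q\<^esub> ?f x" if "a \<in> carrier R" "x \<in> carrier L" for a x
      by (rule inj_onD[OF inj]) (use that f[of "a \<odot>\<^bsub>L\<^esub> x"] in \<open>simp_all add: f gD vD\<close>)
  qed (rule f)
qed

section \<open>Torsion for an idempotent system\<close>

context topologizing_system
begin

text \<open>The hypothesis on \<open>I\<close> says that \<open>J / I\<close> is negligible, since the annihilator of the class of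
  \<open>x\<close> is the ideal of all \<open>a\<close> with \<open>a \<otimes> x \<in> I\<close>. Hence \<open>I\<close> belongs to the product of \<open>\<F>\<close> with itself.\<close>

lemma idempotent_memI:
  assumes idem: "ts_idempotent R \<F>"
    and J: "J \<in> \<F>" and I: "ideal I R" "I \<subseteq> J"
    and carry: "\<And>x. x \<in> J \<Longrightarrow> \<exists>K \<in> \<F>. \<forall>a \<in> K. a \<otimes> x \<in> I"
  shows "I \<in> \<F>"
proof -
  interpret I: ideal I R by fact
  let ?J = "ideal_mod R J"
  interpret J: module R ?J by (rule ideal_mod_module[OF is_cring ideals[OF J]])
  \<comment> \<open>The two negatives are inverses in different structures; both are the multiple by \<open>-1\<close>.\<close>
  have neg: "\<ominus>\<^bsub>?J\<^esub> x = \<ominus> x" if "x \<in> J" for x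
  proof -
    have "\<ominus>\<^bsub>?J\<^esub> x = (\<ominus> \<one>) \<odot>\<^bsub>?J\<^esub> x"
      using that J.smult_l_minus[of \<one> x] J.smult_one[of x] by (simp del: J.smult_one)
    also have "\<dots> = \<ominus> x"
      using that mem_subset[OF J] by (auto simp: l_minus)
    finally show ?thesis .
  qed
  have sub: "submodule I R ?J"
    by (rule J.submoduleI) (use I in \<open>auto simp: neg subset_iff I.I_l_closed\<close>)
  have "annihilator R (quot_mod ?J I) X \<in> \<F>" if X: "X \<in> carrier (quot_mod ?J I)" for X
  proof -
    obtain x where x: "x \<in> carrier ?J" "X = I +>\<^bsub>?J\<^esub> x"
      using X by (rule quot_mod_cases)
    from x(1) carry obtain K where K: "K \<in> \<F>" "\<forall>a \<in> K. a \<otimes> x \<in> I" by auto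
    have "K \<subseteq> annihilator R (quot_mod ?J I) X"
      unfolding x(2) annihilator_coset[OF J.module_axioms sub x(1)]
      using K mem_subset[OF K(1)] by auto
    then show ?thesis
      using upward[OF K(1) annihilator_ideal[OF quot_mod_module[OF J.module_axioms sub] X]] by blast
  qed
  then have "negligible R \<F> (quot_mod ?J I)"
    by (simp add: negligible_def)
  then have "I \<in> ts_prod R \<F> \<F>"
    using J I by (auto simp: ts_prod_def)
  then show ?thesis
    using idem by (simp add: ts_idempotent_def)
qed

text \<open>In other words, \<open>M / \<F>(M)\<close> is torsion-free. The ideal to which the criterion above applies
  is the part of the annihilator of \<open>m\<close> inside \<open>J\<close>: for \<open>x \<in> J\<close> the annihilator of the torsion
  element \<open>x \<odot> m\<close> carries \<open>x\<close> into it.\<close>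

lemma torsion_extension_closed:
  assumes idem: "ts_idempotent R \<F>" and M: "module R M"
    and J: "J \<in> \<F>" and m: "m \<in> carrier M"
    and carry: "\<And>x. x \<in> J \<Longrightarrow> x \<odot>\<^bsub>M\<^esub> m \<in> torsion R \<F> M"
  shows "m \<in> torsion R \<F> M"
proof -
  interpret M: module R M by fact
  let ?A = "annihilator R M m"
  have "?A \<inter> J \<in> \<F>"
  proof (rule idempotent_memI[OF idem J])
    show "ideal (?A \<inter> J) R"
      by (rule i_intersect[OF annihilator_ideal[OF M m] ideals[OF J]])
    fix x assume x: "x \<in> J"
    then have xR: "x \<in> carrier R" using mem_subset[OF J] by blast
    have "a \<otimes> x \<in> ?A \<inter> J" if "a \<in> annihilator R M (x \<odot>\<^bsub>M\<^esub> m)" for a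
      using that xR m ideal_ops(2)[OF J x] by (auto simp: annihilator_def M.smult_assoc1)
    then show "\<exists>K \<in> \<F>. \<forall>a \<in> K. a \<otimes> x \<in> ?A \<inter> J"
      using carry[OF x] by (auto simp: torsion_def)
  qed simp
  then have "?A \<in> \<F>"
    using upward annihilator_ideal[OF M m] by blast
  then show ?thesis
    using m by (simp add: torsion_def)
qed

text \<open>Whatever annihilates \<open>u m\<close> carries \<open>m\<close> into the kernel of \<open>u\<close>, and negligibility of the
  kernel means that it consists of torsion elements.\<close>

lemma torsion_reflect:
  assumes idem: "ts_idempotent R \<F>" and M: "module R M" and N: "module R N"
    and u: "u \<in> mod_hom R M N" and ker: "negligible R \<F> (ker_mod M N u)"
    and m: "m \<in> carrier M" "u m \<in> torsion R \<F> N"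
  shows "m \<in> torsion R \<F> M"
proof (rule torsion_extension_closed[OF idem M _ m(1)])
  interpret M: module R M by fact
  show "annihilator R N (u m) \<in> \<F>"
    using m(2) by (simp add: torsion_def)
  fix a assume a: "a \<in> annihilator R N (u m)"
  have "a \<odot>\<^bsub>M\<^esub> m \<in> carrier (ker_mod M N u)"
    using a m mod_homD(3)[OF u] by (auto simp: annihilator_def ker_mod_def a_kernel_def')
  then show "a \<odot>\<^bsub>M\<^esub> m \<in> torsion R \<F> M"
    using ker by (auto simp: negligible_def torsion_def annihilator_def ker_mod_def a_kernel_def')
qed

section \<open>The map induced on torsion-free quotients\<close>

text \<open>If two classes have the same image, \<open>u\<close> maps the difference of their representatives into
  \<open>\<F>(N)\<close>, so this difference already lies in \<open>\<F>(M)\<close> by the preceding lemma.\<close>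

lemma induced_map_inj_on:
  assumes idem: "ts_idempotent R \<F>" and M: "module R M" and N: "module R N"
    and u: "u \<in> mod_hom R M N" and ker: "negligible R \<F> (ker_mod M N u)"
  shows "inj_on (quot_map N (torsion R \<F> N) u) (carrier (quot_mod M (torsion R \<F> M)))"
proof (rule inj_onI)
  interpret M: module R M by fact
  interpret N: module R N by fact
  let ?T = "torsion R \<F> M" and ?S = "torsion R \<F> N"
  note T = torsion_submodule[OF topologizing_system_axioms M]
    and S = torsion_submodule[OF topologizing_system_axioms N]
  interpret T: abelian_subgroup ?T M by (rule submodule_abelian_subgroup[OF M T])
  interpret S: abelian_subgroup ?S N by (rule submodule_abelian_subgroup[OF N S])
  have uT: "u ` ?T \<subseteq> ?S"
    using torsion_mono[OF topologizing_system_axioms M N u] by blast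
  note coset = quot_map_coset[OF M N T S u uT] and uD = mod_homD[OF u]
  fix X Y assume "X \<in> carrier (quot_mod M ?T)" "Y \<in> carrier (quot_mod M ?T)"
    and eq: "quot_map N ?S u X = quot_map N ?S u Y"
  then obtain x y where x: "x \<in> carrier M" "X = ?T +>\<^bsub>M\<^esub> x" and y: "y \<in> carrier M" "Y = ?T +>\<^bsub>M\<^esub> y"
    by (meson quot_mod_cases)
  have "u x \<in> ?S +>\<^bsub>N\<^esub> u y"
    using eq x y S.a_rcos_self[OF uD(1)[OF x(1)]] by (simp add: coset)
  then obtain s where s: "s \<in> ?S" "u x = s \<oplus>\<^bsub>N\<^esub> u y"
    by (auto simp: a_r_coset_def')
  let ?d = "x \<ominus>\<^bsub>M\<^esub> y"
  have d: "?d \<in> carrier M" "x = ?d \<oplus>\<^bsub>M\<^esub> y"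
    using x y by (auto simp: M.M.minus_eq M.M.a_assoc M.M.l_neg)
  have "u ?d \<oplus>\<^bsub>N\<^esub> u y = s \<oplus>\<^bsub>N\<^esub> u y"
    using s(2) uD(2)[OF d(1) y(1)] d(2) by simp
  then have "u ?d = s"
    using d(1) y(1) s(1) uD(1) S.a_Hcarr by simp
  then have "?d \<in> ?T"
    using torsion_reflect[OF idem M N u ker d(1)] s(1) by simp
  then have "x \<in> ?T +>\<^bsub>M\<^esub> y"
    using d(2) by (auto simp: a_r_coset_def')
  then show "X = Y"
    using x y T.a_repr_independence' by blast
qed

text \<open>If \<open>n\<close> represents \<open>g x\<close>, the annihilator of the class of \<open>n\<close> in the cokernel carries \<open>n\<close>
  into the image of \<open>u\<close>, hence \<open>x\<close> into the ideal in question. Negligibility of the cokernel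
  thus supplies what the criterion for membership in \<open>\<F>\<close> asks for.\<close>

lemma liftable_part_mem:
  assumes idem: "ts_idempotent R \<F>" and M: "module R M" and N: "module R N"
    and u: "u \<in> mod_hom R M N" and coker: "negligible R \<F> (coker_mod M N u)"
    and I: "I \<in> \<F>" and g: "g \<in> mod_hom R (ideal_mod R I) (quot_mod N (torsion R \<F> N))"
  shows "{x \<in> I. g x \<in> quot_map N (torsion R \<F> N) u ` carrier (quot_mod M (torsion R \<F> M))} \<in> \<F>"
    (is "?K \<in> \<F>")
proof (rule idempotent_memI[OF idem I])
  let ?T = "torsion R \<F> M" and ?S = "torsion R \<F> N"
  let ?P = "quot_map N ?S u ` carrier (quot_mod M ?T)"
  note T = torsion_submodule[OF topologizing_system_axioms M]
    and S = torsion_submodule[OF topologizing_system_axioms N]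
  have uT: "u ` ?T \<subseteq> ?S"
    using torsion_mono[OF topologizing_system_axioms M N u] by blast
  note coset = quot_map_coset[OF M N T S u uT]
    and img = image_submodule[OF M N u]
    and gD = mod_homD[OF g, unfolded ideal_mod_simps]
  show "ideal ?K R"
    by (rule ideal_preimage_submodule[OF is_cring ideals[OF I] quot_mod_module[OF N S]
          image_submodule[OF quot_mod_module[OF M T] quot_mod_module[OF N S]
            quot_map_mod_hom[OF M N T S u uT]] g])
  fix x assume x: "x \<in> I"
  obtain n where n: "n \<in> carrier N" "g x = ?S +>\<^bsub>N\<^esub> n"
    using gD(1)[OF x] by (rule quot_mod_cases)
  let ?A = "{a \<in> carrier R. a \<odot>\<^bsub>N\<^esub> n \<in> u ` carrier M}"
  have "?A \<in> \<F>"
    using coker quot_mod_closed[OF n(1), of "u ` carrier M"]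
    unfolding negligible_def coker_mod_def annihilator_coset[OF N img n(1), symmetric] by blast
  moreover have "a \<otimes> x \<in> ?K" if a: "a \<in> ?A" for a
  proof -
    from a obtain m where m: "m \<in> carrier M" "a \<odot>\<^bsub>N\<^esub> n = u m" and aR: "a \<in> carrier R" by blast
    have "g (a \<otimes> x) = ?S +>\<^bsub>N\<^esub> u m"
      unfolding gD(3)[OF aR x] n(2) quot_mod_smult[OF N S aR n(1)] m(2) by (rule refl)
    also have "\<dots> = quot_map N ?S u (?T +>\<^bsub>M\<^esub> m)"
      by (rule coset[OF m(1), symmetric])
    also have "\<dots> \<in> ?P"
      by (rule imageI[OF quot_mod_closed[OF m(1)]])
    finally show ?thesis
      using ideal_ops(2)[OF I x aR] by blast
  qed
  ultimately show "\<exists>K \<in> \<F>. \<forall>a \<in> K. a \<otimes> x \<in> ?K" by blast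
qed auto

end

section \<open>The map induced on localizations\<close>

theorem theorem2p14:
  fixes R :: "('a, 'r) ring_scheme"
    and \<F> :: "'a set set"
    and M :: "('a, 'b, 'm) module_scheme"
    and N :: "('a, 'c, 'n) module_scheme"
    and \<phi> :: "'b \<Rightarrow> 'c"
  assumes "cring R"
    and "topologizing_system R \<F>"
    and "ts_idempotent R \<F>"
    and "module R M"
    and "module R N"
    and "\<phi> \<in> mod_hom R M N"
    and "negligible R \<F> (ker_mod M N \<phi>)"
    and "negligible R \<F> (coker_mod M N \<phi>)"
  shows "bij_betw (localization_map R \<F> M N \<phi>)
    (carrier (localization R \<F> M)) (carrier (localization R \<F> N))"
proof -
  interpret topologizing_system R \<F> by fact
  let ?S = "torsion R \<F> N"
  let ?Q = "quot_mod M (torsion R \<F> M)" and ?v = "quot_map N ?S \<phi>"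
  let ?C = "loc_class R \<F> M" and ?D = "loc_class R \<F> N"
  note T = torsion_submodule[OF assms(2,4)] and S = torsion_submodule[OF assms(2,5)]
  have v: "?v \<in> mod_hom R ?Q (quot_mod N ?S)"
    using torsion_mono[OF assms(2,4,5,6)] by (intro quot_map_mod_hom assms T S) auto
  have inj: "inj_on ?v (carrier ?Q)"
    by (rule induced_map_inj_on[OF assms(3-7)])
  note map = localization_map_class[OF assms(4-6)] and pre = loc_pre_map[OF assms(4-6)]
  have val: "f x \<in> carrier ?Q" if "(I, f) \<in> loc_pre R \<F> M" "x \<in> I" for I f x
    using that mod_homD(1)[of f R "ideal_mod R I" ?Q x] by (auto simp: loc_pre_def)
  have "inj_on (localization_map R \<F> M N \<phi>) (carrier (localization R \<F> M))"
  proof (rule inj_onI)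
    fix X Y assume "X \<in> carrier (localization R \<F> M)" "Y \<in> carrier (localization R \<F> M)"
      and eq: "localization_map R \<F> M N \<phi> X = localization_map R \<F> M N \<phi> Y"
    then obtain I f J g where X: "(I, f) \<in> loc_pre R \<F> M" "X = ?C I f"
      and Y: "(J, g) \<in> loc_pre R \<F> M" "Y = ?C J g"
      by (metis localization_cases)
    have "?D I (\<lambda>x \<in> I. ?v (f x)) = ?D J (\<lambda>x \<in> J. ?v (g x))"
      using eq unfolding X(2) Y(2) map[OF X(1)] map[OF Y(1)] .
    then obtain K where K: "K \<in> \<F>" "K \<subseteq> I \<inter> J"
      and agree: "\<And>x. x \<in> K \<Longrightarrow> restrict (\<lambda>x. ?v (f x)) I x = restrict (\<lambda>x. ?v (g x)) J x"
      unfolding loc_class_eq_iff[OF pre[OF X(1)] pre[OF Y(1)]] by blast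
    have "f x = g x" if x: "x \<in> K" for x
    proof (rule inj_onD[OF inj])
      show "?v (f x) = ?v (g x)" using agree[OF x] subsetD[OF K(2) x] by simp
    qed (use x K(2) val[OF X(1)] val[OF Y(1)] in auto)
    then show "X = Y"
      unfolding X(2) Y(2) loc_class_eq_iff[OF X(1) Y(1)] using K by blast
  qed
  moreover have "Z \<in> carrier (localization R \<F> N)"
    if "Z \<in> localization_map R \<F> M N \<phi> ` carrier (localization R \<F> M)" for Z
  proof -
    from that obtain X where "X \<in> carrier (localization R \<F> M)" "Z = localization_map R \<F> M N \<phi> X"
      by blast
    then show ?thesis
      by (metis localization_cases map pre localization_closed)
  qed
  moreover have "Z \<in> localization_map R \<F> M N \<phi> ` carrier (localization R \<F> M)"
    if "Z \<in> carrier (localization R \<F> N)" for Z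
  proof -
    from that obtain I g where Z: "(I, g) \<in> loc_pre R \<F> N" "Z = ?D I g"
      by (rule localization_cases)
    from Z(1) have I: "I \<in> \<F>" and g: "g \<in> mod_hom R (ideal_mod R I) (quot_mod N ?S)"
      by (auto simp: loc_pre_def)
    let ?K = "{x \<in> I. g x \<in> ?v ` carrier ?Q}"
    let ?f = "\<lambda>x \<in> ?K. inv_into (carrier ?Q) ?v (g x)"
    have K: "?K \<in> \<F>"
      by (rule liftable_part_mem[OF assms(3-6,8) I g])
    have f: "(?K, ?f) \<in> loc_pre R \<F> M"
    proof (rule loc_preI[OF K], rule mod_hom_inv_into[OF _ _ _ v inj])
      show "g \<in> mod_hom R (ideal_mod R ?K) (quot_mod N ?S)"
        by (rule mod_hom_subset[OF g]) blast
    qed (use ideal_mod_module[OF is_cring ideals[OF K]] quot_mod_module[OF assms(4) T] in auto)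
    have "?D ?K (\<lambda>x \<in> ?K. ?v (?f x)) = ?D I g"
      unfolding loc_class_eq_iff[OF pre[OF f] Z(1)]
      by (intro bexI[OF _ K]) (auto simp: f_inv_into_f simp del: quot_mod_simps)
    then have "Z = localization_map R \<F> M N \<phi> (?C ?K ?f)"
      unfolding Z(2) map[OF f] by (rule sym)
    then show ?thesis
      using localization_closed[OF f] by (rule image_eqI)
  qed
  ultimately show ?thesis
    unfolding bij_betw_def by blast
qed

end
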